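(* Let $n\ge 3$ be an integer, $K$ a field, and $T=K[x_1,\ldots,x_n,y_1,\ldots,y_n]$, with indices of variables taken modulo $n$ (so $x_0=x_n$, $y_0=y_n$). Let $J\subset T$ be the defining ideal of the Rees algebra $R(I_{n-2}(C_n))$. Let $L=(f_1,\ldots,f_n)\subset T$, where $f_j=x_{n-2+j}y_j-x_jy_{j+1}$ for $j=1,\ldots,n$. When $n$ is even, let $H=(h)\subset K[y_1,\ldots,y_n]$, where $h=\prod_{i=0}^{\frac n2-1}y_{2i}-\prod_{i=0}^{\frac n2-1}y_{2i+1}$. Then $J=L$ if $n$ is odd, and $J=L+HT$ if $n$ is even.
   Context: Let $S=K[x_1,\ldots,x_n]$. $I_{n-2}(C_n)\subset S$ is the $(n-2)$-path ideal of the $n$-cycle, generated by the monomials $u_j=x_jx_{j+1}\cdots x_{j+n-3}$, $j=1,\ldots,n$ (indices modulo $n$). The Rees algebra of $I=I_{n-2}(C_n)$ is $R(I)=S[u_1s,\ldots,u_ns]\subset S[s]$, with $s$ a new variable, and its defining ideal is $J=\ker(\varphi)$, where $\varphi:T=S[y_1,\ldots,y_n]\to R(I)$ is the surjective $K$-algebra homomorphism with $\varphi(x_i)=x_i$ and $\varphi(y_j)=u_js$. *)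

theory Defs
  imports "HOL-Algebra.Algebra" "HOL-Library.Poly_Mapping"
begin

section \<open>Polynomial rings\<close>

text \<open>
  A polynomial is a finitely supported map from monomials to coefficients, a monomial being a
  finitely supported exponent function on the variables; the type class multiplication of
  \<^typ>\<open>('v \<Rightarrow>\<^sub>0 nat) \<Rightarrow>\<^sub>0 'k\<close> is the convolution product.
\<close>

type_synonym ('v, 'k) mpoly = "('v \<Rightarrow>\<^sub>0 nat) \<Rightarrow>\<^sub>0 'k"

definition Const :: "'k \<Rightarrow> ('v, 'k :: comm_ring_1) mpoly" where
  "Const c = Poly_Mapping.single 0 c"

definition Var :: "'v \<Rightarrow> ('v, 'k :: comm_ring_1) mpoly" where
  "Var v = Poly_Mapping.single (Poly_Mapping.single v 1) 1"

text \<open>The ring of polynomials in which only variables from \<open>V\<close> occur.\<close>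

definition poly_ring :: "'v set \<Rightarrow> ('v, 'k :: comm_ring_1) mpoly ring" where
  "poly_ring V =
     \<lparr>carrier = {p. \<forall>m \<in> Poly_Mapping.keys p. Poly_Mapping.keys m \<subseteq> V},
      monoid.mult = (*), one = 1, ring.zero = 0, add = (+)\<rparr>"

text \<open>The \<open>K\<close>-algebra homomorphism sending each variable \<open>v\<close> to \<open>\<sigma> v\<close>.\<close>

definition mon_subst ::
    "('v \<Rightarrow> ('w, 'k :: comm_ring_1) mpoly) \<Rightarrow> ('v \<Rightarrow>\<^sub>0 nat) \<Rightarrow> ('w, 'k) mpoly" where
  "mon_subst \<sigma> m = (\<Prod>v \<in> Poly_Mapping.keys m. \<sigma> v ^ Poly_Mapping.lookup m v)"

definition psubst ::
    "('v \<Rightarrow> ('w, 'k :: comm_ring_1) mpoly) \<Rightarrow> ('v, 'k) mpoly \<Rightarrow> ('w, 'k) mpoly" where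
  "psubst \<sigma> p = (\<Sum>m \<in> Poly_Mapping.keys p. Const (Poly_Mapping.lookup p m) * mon_subst \<sigma> m)"

lemma poly_ring_simps [simp]:
  "p \<otimes>\<^bsub>poly_ring V\<^esub> q = p * q" "p \<oplus>\<^bsub>poly_ring V\<^esub> q = p + q"
  "\<one>\<^bsub>poly_ring V\<^esub> = 1" "\<zero>\<^bsub>poly_ring V\<^esub> = 0"
  by (simp_all add: poly_ring_def)

lemma carrier_poly_ring:
  "p \<in> carrier (poly_ring V) \<longleftrightarrow> (\<forall>m \<in> Poly_Mapping.keys p. Poly_Mapping.keys m \<subseteq> V)"
  by (simp add: poly_ring_def)

lemma Var_in_carrier: "Var v \<in> carrier (poly_ring V) \<longleftrightarrow> v \<in> V"
  by (simp add: carrier_poly_ring Var_def)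

lemma Const_in_carrier: "Const c \<in> carrier (poly_ring V)"
  by (simp add: carrier_poly_ring Const_def)

lemma add_in_carrier:
  "p \<in> carrier (poly_ring V) \<Longrightarrow> q \<in> carrier (poly_ring V) \<Longrightarrow> p + q \<in> carrier (poly_ring V)"
  unfolding carrier_poly_ring using keys_add[of p q] by blast

lemma mult_in_carrier:
  assumes "p \<in> carrier (poly_ring V)" "q \<in> carrier (poly_ring V)"
  shows "p * q \<in> carrier (poly_ring V)"
  unfolding carrier_poly_ring
proof
  fix m assume "m \<in> Poly_Mapping.keys (p * q)"
  then obtain a b where "m = a + b" "a \<in> Poly_Mapping.keys p" "b \<in> Poly_Mapping.keys q"
    using keys_mult[of p q] by blast
  then show "Poly_Mapping.keys m \<subseteq> V"
    using assms keys_add[of a b] unfolding carrier_poly_ring by blast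
qed

lemma uminus_in_carrier:
  "p \<in> carrier (poly_ring V) \<Longrightarrow> - p \<in> carrier (poly_ring V)"
  by (auto simp: carrier_poly_ring in_keys_iff)

lemma poly_ring_cring: "cring (poly_ring V :: ('v, 'k :: comm_ring_1) mpoly ring)"
proof (rule cringI)
  show "abelian_group (poly_ring V :: ('v, 'k) mpoly ring)"
  proof (rule abelian_groupI)
    fix p :: "('v, 'k) mpoly" assume "p \<in> carrier (poly_ring V)"
    then show "\<exists>q \<in> carrier (poly_ring V). q \<oplus>\<^bsub>poly_ring V\<^esub> p = \<zero>\<^bsub>poly_ring V\<^esub>"
      by (intro bexI[of _ "- p"]) (simp_all add: uminus_in_carrier)
  qed (simp_all add: add_in_carrier add_ac carrier_poly_ring[of 0])
  show "comm_monoid (poly_ring V :: ('v, 'k) mpoly ring)"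
    by (rule comm_monoidI) (simp_all add: mult_in_carrier mult_ac carrier_poly_ring[of 1])
qed (simp add: distrib_right)

lemma Const_simps:
  "Const 0 = 0" "Const 1 = 1" "Const (a + b) = Const a + Const b" "Const (a * b) = Const a * Const b"
  by (simp_all add: Const_def single_add mult_single)

lemma mon_subst_superset:
  assumes "finite A" "Poly_Mapping.keys m \<subseteq> A"
  shows "mon_subst \<sigma> m = (\<Prod>v \<in> A. \<sigma> v ^ Poly_Mapping.lookup m v)"
  unfolding mon_subst_def
  by (rule prod.mono_neutral_left) (use assms in \<open>auto simp: in_keys_iff\<close>)

lemma mon_subst_add: "mon_subst \<sigma> (a + b) = mon_subst \<sigma> a * mon_subst \<sigma> b"
proof -
  let ?A = "Poly_Mapping.keys a \<union> Poly_Mapping.keys b"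
  have "Poly_Mapping.keys (a + b) \<subseteq> ?A" by (rule keys_add)
  then show ?thesis
    by (simp add: mon_subst_superset[of ?A] lookup_add power_add prod.distrib)
qed

lemma psubst_superset:
  assumes "finite A" "Poly_Mapping.keys p \<subseteq> A"
  shows "psubst \<sigma> p = (\<Sum>m \<in> A. Const (Poly_Mapping.lookup p m) * mon_subst \<sigma> m)"
  unfolding psubst_def
  by (rule sum.mono_neutral_left) (use assms in \<open>auto simp: in_keys_iff Const_simps\<close>)

lemma psubst_add: "psubst \<sigma> (p + q) = psubst \<sigma> p + psubst \<sigma> q"
proof -
  let ?A = "Poly_Mapping.keys p \<union> Poly_Mapping.keys q"
  have "Poly_Mapping.keys (p + q) \<subseteq> ?A" by (rule keys_add)
  then show ?thesis
    by (simp add: psubst_superset[of ?A] lookup_add Const_simps distrib_right sum.distrib)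
qed

lemma psubst_single: "psubst \<sigma> (Poly_Mapping.single m c) = Const c * mon_subst \<sigma> m"
  by (simp add: psubst_superset[of "{m}"])

lemma psubst_0 [simp]: "psubst \<sigma> 0 = 0"
  by (simp add: psubst_def)

lemma psubst_sum: "psubst \<sigma> (\<Sum>i \<in> A. g i) = (\<Sum>i \<in> A. psubst \<sigma> (g i))"
  by (induction A rule: infinite_finite_induct) (simp_all add: psubst_add)

lemma mpoly_expand:
  fixes p :: "('v, 'k :: comm_ring_1) mpoly"
  shows "p = (\<Sum>m \<in> Poly_Mapping.keys p. Poly_Mapping.single m (Poly_Mapping.lookup p m))"
  by (rule poly_mapping_eqI) (simp add: lookup_sum lookup_single when_def in_keys_iff)

lemma psubst_mult: "psubst \<sigma> (p * q) = psubst \<sigma> p * psubst \<sigma> q"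
proof -
  have "p * q = (\<Sum>a \<in> Poly_Mapping.keys p. \<Sum>b \<in> Poly_Mapping.keys q.
      Poly_Mapping.single (a + b) (Poly_Mapping.lookup p a * Poly_Mapping.lookup q b))"
    by (subst mpoly_expand[of p], subst mpoly_expand[of q]) (simp add: sum_product mult_single)
  then have "psubst \<sigma> (p * q) = (\<Sum>a \<in> Poly_Mapping.keys p. \<Sum>b \<in> Poly_Mapping.keys q.
      Const (Poly_Mapping.lookup p a * Poly_Mapping.lookup q b) * mon_subst \<sigma> (a + b))"
    by (simp add: psubst_sum psubst_single)
  also have "\<dots> = psubst \<sigma> p * psubst \<sigma> q"
    unfolding psubst_def by (simp add: mon_subst_add Const_simps sum_product mult_ac)
  finally show ?thesis .
qed

lemma psubst_Const: "psubst \<sigma> (Const c) = Const c"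
  by (simp add: Const_def psubst_single mon_subst_def)

lemma psubst_1 [simp]: "psubst \<sigma> 1 = 1"
  using psubst_Const[of \<sigma> 1] by (simp add: Const_simps)

lemma psubst_Var: "psubst \<sigma> (Var v) = \<sigma> v"
  by (simp add: Var_def psubst_single mon_subst_def Const_simps)


section \<open>The Rees algebra of the path ideal\<close>

text \<open>
  All rings below live in one polynomial type. Indices of variables are taken modulo \<open>n\<close>, with
  representatives \<open>0, \<dots>, n - 1\<close>; thus \<open>xv n n = xv n 0\<close> and \<open>yv n n = yv n 0\<close>.
\<close>

datatype var = XVar nat | YVar nat | SVar

definition xv :: "nat \<Rightarrow> nat \<Rightarrow> (var, 'k :: comm_ring_1) mpoly" where
  "xv n i = Var (XVar (i mod n))"

definition yv :: "nat \<Rightarrow> nat \<Rightarrow> (var, 'k :: comm_ring_1) mpoly" where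
  "yv n i = Var (YVar (i mod n))"

definition sv :: "(var, 'k :: comm_ring_1) mpoly" where
  "sv = Var SVar"

definition ring_x :: "nat \<Rightarrow> (var, 'k :: comm_ring_1) mpoly ring" where
  "ring_x n = poly_ring (XVar ` {..<n})"

definition ring_y :: "nat \<Rightarrow> (var, 'k :: comm_ring_1) mpoly ring" where
  "ring_y n = poly_ring (YVar ` {..<n})"

definition ring_xs :: "nat \<Rightarrow> (var, 'k :: comm_ring_1) mpoly ring" where
  "ring_xs n = poly_ring (XVar ` {..<n} \<union> {SVar})"

definition ring_xy :: "nat \<Rightarrow> (var, 'k :: comm_ring_1) mpoly ring" where
  "ring_xy n = poly_ring (XVar ` {..<n} \<union> YVar ` {..<n})"

text \<open>The generators of the \<open>(n - 2)\<close>-path ideal of the \<open>n\<close>-cycle, for \<open>n \<ge> 3\<close>;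
  \<open>path_gen n j\<close> depends only on \<open>j mod n\<close>.\<close>

definition path_gen :: "nat \<Rightarrow> nat \<Rightarrow> (var, 'k :: comm_ring_1) mpoly" where
  "path_gen n j = (\<Prod>i = j..j + n - 3. xv n i)"

definition rees_algebra :: "nat \<Rightarrow> (var, 'k :: comm_ring_1) mpoly ring" where
  "rees_algebra n =
     (ring_xs n)\<lparr>carrier :=
        generate_ring (ring_xs n) (carrier (ring_x n) \<union> {path_gen n j * sv | j. j \<in> {1..n}})\<rparr>"

text \<open>The value at \<open>SVar\<close> is irrelevant, since \<open>SVar\<close> does not occur in \<open>ring_xy n\<close>.\<close>

definition rees_map :: "nat \<Rightarrow> (var, 'k :: comm_ring_1) mpoly \<Rightarrow> (var, 'k) mpoly" where
  "rees_map n =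
     psubst (\<lambda>v. case v of XVar i \<Rightarrow> xv n i | YVar j \<Rightarrow> path_gen n j * sv | SVar \<Rightarrow> sv)"

definition rees_ideal :: "nat \<Rightarrow> (var, 'k :: comm_ring_1) mpoly set" where
  "rees_ideal n = a_kernel (ring_xy n) (rees_algebra n) (rees_map n)"

definition f_gen :: "nat \<Rightarrow> nat \<Rightarrow> (var, 'k :: comm_ring_1) mpoly" where
  "f_gen n j = xv n (n - 2 + j) * yv n j - xv n j * yv n (j + 1)"

definition L_ideal :: "nat \<Rightarrow> (var, 'k :: comm_ring_1) mpoly set" where
  "L_ideal n = Idl\<^bsub>ring_xy n\<^esub> {f_gen n j | j. j \<in> {1..n}}"

definition h_gen :: "nat \<Rightarrow> (var, 'k :: comm_ring_1) mpoly" where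
  "h_gen n = (\<Prod>i = 0..n div 2 - 1. yv n (2 * i)) - (\<Prod>i = 0..n div 2 - 1. yv n (2 * i + 1))"

definition H_ideal :: "nat \<Rightarrow> (var, 'k :: comm_ring_1) mpoly set" where
  "H_ideal n = Idl\<^bsub>ring_y n\<^esub> {h_gen n}"

text \<open>The extension \<open>HT\<close> of \<open>H\<close> along \<open>K[y] \<subseteq> T\<close>.\<close>

definition HT_ideal :: "nat \<Rightarrow> (var, 'k :: comm_ring_1) mpoly set" where
  "HT_ideal n = Idl\<^bsub>ring_xy n\<^esub> (H_ideal n)"

text \<open>
  The objects above are as intended: \<open>rees_map n\<close> is a \<open>K\<close>-algebra homomorphism from
  \<open>ring_xy n\<close> onto \<open>rees_algebra n\<close> with the prescribed values on the variables.
\<close>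

lemma path_gen_mod:
  assumes "n \<ge> 3"
  shows "path_gen n (j mod n) = (path_gen n j :: (var, 'k :: comm_ring_1) mpoly)"
proof -
  have shift: "{i..i + n - 3} = {0 + i..(n - 3) + i}" for i
    using assms by (simp add: add.commute)
  have "path_gen n i = (\<Prod>k = 0..n - 3. Var (XVar ((k + i) mod n)) :: (var, 'k) mpoly)" for i
    unfolding path_gen_def shift xv_def by (rule prod.shift_bounds_cl_nat_ivl)
  then show ?thesis by (simp add: mod_add_right_eq)
qed

lemma rees_map_xv: "rees_map n (xv n i) = xv n i"
  by (simp add: rees_map_def xv_def psubst_Var)

lemma rees_map_yv: "n \<ge> 3 \<Longrightarrow> rees_map n (yv n j) = path_gen n j * sv"
  by (simp add: rees_map_def yv_def psubst_Var path_gen_mod)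

lemma rees_map_Const: "rees_map n (Const c) = Const c"
  by (simp add: rees_map_def psubst_Const)

lemma ring_x_subset_xs: "carrier (ring_x n) \<subseteq> carrier (ring_xs n)"
  unfolding ring_x_def ring_xs_def by (auto simp: carrier_poly_ring) blast

lemma prod_in_carrier:
  "(\<And>i. i \<in> A \<Longrightarrow> g i \<in> carrier (poly_ring V)) \<Longrightarrow> (\<Prod>i \<in> A. g i) \<in> carrier (poly_ring V)"
  by (induction A rule: infinite_finite_induct)
    (simp_all add: mult_in_carrier carrier_poly_ring[of 1])

lemma rees_gens_in_carrier:
  assumes "n \<ge> 3"
  shows "carrier (ring_x n) \<union> {path_gen n j * sv | j. j \<in> {1..n}} \<subseteq>
    carrier (ring_xs n :: (var, 'k :: comm_ring_1) mpoly ring)"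
proof -
  have "path_gen n j * sv \<in> carrier (ring_xs n :: (var, 'k) mpoly ring)" for j
    unfolding ring_xs_def path_gen_def
    by (intro mult_in_carrier prod_in_carrier)
      (use assms in \<open>auto simp: xv_def sv_def Var_in_carrier\<close>)
  then show ?thesis using ring_x_subset_xs by auto
qed

lemma rees_algebra_subring:
  assumes "n \<ge> 3"
  shows "subring (carrier (rees_algebra n)) (ring_xs n :: (var, 'k :: comm_ring_1) mpoly ring)"
proof -
  interpret cring "ring_xs n :: (var, 'k) mpoly ring" unfolding ring_xs_def by (rule poly_ring_cring)
  show ?thesis
    using generate_ring_is_subring[OF rees_gens_in_carrier[OF assms]]
    by (simp add: rees_algebra_def)
qed

lemma rees_algebra_ops [simp]:
  "p \<otimes>\<^bsub>rees_algebra n\<^esub> q = p * q" "p \<oplus>\<^bsub>rees_algebra n\<^esub> q = p + q"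
  "\<one>\<^bsub>rees_algebra n\<^esub> = 1" "\<zero>\<^bsub>rees_algebra n\<^esub> = 0"
  by (simp_all add: rees_algebra_def ring_xs_def)

lemma poly_ring_induct [consumes 1, case_names Const Var add mult]:
  fixes p :: "('a, 'b :: comm_ring_1) mpoly"
  assumes "p \<in> carrier (poly_ring V)"
    and "\<And>c. P (Const c)"
    and "\<And>v. v \<in> V \<Longrightarrow> P (Var v)"
    and add: "\<And>p q. P p \<Longrightarrow> P q \<Longrightarrow> P (p + q)"
    and mult: "\<And>p q. P p \<Longrightarrow> P q \<Longrightarrow> P (p * q)"
  shows "P p"
proof -
  have P0: "P 0" and P1: "P 1" using assms(2)[of 0] assms(2)[of 1] by (simp_all add: Const_simps)
  have pow: "P (q ^ k)" if "P q" for q k by (induction k) (use that P1 mult in auto)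
  have prd: "P (\<Prod>i \<in> A. g i)" if "\<And>i. i \<in> A \<Longrightarrow> P (g i)" for A and g :: "'a \<Rightarrow> _"
    using that by (induction A rule: infinite_finite_induct) (use P1 mult in auto)
  have sm: "P (\<Sum>i \<in> A. g i)" if "\<And>i. i \<in> A \<Longrightarrow> P (g i)" for A and g :: "('a \<Rightarrow>\<^sub>0 nat) \<Rightarrow> _"
    using that by (induction A rule: infinite_finite_induct) (use P0 add in auto)
  have Var_pow: "Var v ^ k = (Poly_Mapping.single (Poly_Mapping.single v k) 1 :: ('a, 'b) mpoly)"
    for v k
    by (induction k) (simp_all add: Var_def mult_single flip: single_add)
  have prod_single:
    "(\<Prod>v \<in> A. Poly_Mapping.single (e v) 1) =
      (Poly_Mapping.single (\<Sum>v \<in> A. e v) 1 :: ('a, 'b) mpoly)"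
    for A and e :: "'a \<Rightarrow> 'a \<Rightarrow>\<^sub>0 nat"
    by (induction A rule: infinite_finite_induct) (simp_all add: mult_single)
  have mon_expand: "m = (\<Sum>v \<in> Poly_Mapping.keys m. Poly_Mapping.single v (Poly_Mapping.lookup m v))"
    for m :: "'a \<Rightarrow>\<^sub>0 nat"
    by (rule poly_mapping_eqI) (simp add: lookup_sum lookup_single when_def in_keys_iff)
  have single: "Poly_Mapping.single m c = Const c * mon_subst Var m"
    for m :: "'a \<Rightarrow>\<^sub>0 nat" and c :: 'b
  proof -
    have "mon_subst Var m = (Poly_Mapping.single m 1 :: ('a, 'b) mpoly)"
      unfolding mon_subst_def Var_pow prod_single by (simp flip: mon_expand)
    then show ?thesis by (simp add: Const_def mult_single)
  qed
  show ?thesis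
  proof (subst mpoly_expand[of p], rule sm)
    fix m assume "m \<in> Poly_Mapping.keys p"
    then have "Poly_Mapping.keys m \<subseteq> V" using assms(1) by (simp add: carrier_poly_ring)
    then show "P (Poly_Mapping.single m (Poly_Mapping.lookup p m))"
      unfolding single mon_subst_def by (intro mult assms(2) prd pow assms(3)) auto
  qed
qed

lemma Var_ring_xy:
  assumes "v \<in> XVar ` {..<n} \<union> YVar ` {..<n}" "n \<ge> 3"
  shows "(\<exists>i. (Var v :: (var, 'k :: comm_ring_1) mpoly) = xv n i) \<or> (\<exists>j \<in> {1..n}. (Var v :: (var, 'k) mpoly) = yv n j)"
  using assms(1)
proof
  assume "v \<in> XVar ` {..<n}"
  then obtain i where "v = XVar i" "i < n" by auto
  then show ?thesis by (intro disjI1 exI[of _ i]) (simp add: xv_def)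
next
  assume "v \<in> YVar ` {..<n}"
  then obtain j where j: "v = YVar j" "j < n" by auto
  show ?thesis
  proof (cases "j = 0")
    case True
    then show ?thesis using j assms(2) by (intro disjI2 bexI[of _ n]) (simp_all add: yv_def)
  next
    case False
    then show ?thesis using j by (intro disjI2 bexI[of _ j]) (simp_all add: yv_def)
  qed
qed

lemma rees_map_hom:
  assumes "n \<ge> 3"
  shows "rees_map n \<in> ring_hom (ring_xy n :: (var, 'k :: comm_ring_1) mpoly ring) (rees_algebra n)"
proof (rule ring_hom_memI)
  fix p :: "(var, 'k) mpoly" assume "p \<in> carrier (ring_xy n)"
  then show "rees_map n p \<in> carrier (rees_algebra n)"
    unfolding ring_xy_def
  proof (induction rule: poly_ring_induct)
    case (Const c)
    then show ?case
      by (auto simp: rees_map_Const rees_algebra_def ring_x_def Const_in_carrier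
          intro: generate_ring.incl)
  next
    case (Var v)
    consider i where "(Var v :: (var, 'k) mpoly) = xv n i" | j where "j \<in> {1..n}" "(Var v :: (var, 'k) mpoly) = yv n j"
      using Var_ring_xy[OF Var assms] by blast
    then show ?case
    proof cases
      case (1 i)
      have "xv n i \<in> carrier (ring_x n :: (var, 'k) mpoly ring)"
        using assms by (auto simp: xv_def ring_x_def Var_in_carrier)
      then show ?thesis
        by (auto simp: 1 rees_map_xv rees_algebra_def intro: generate_ring.incl)
    next
      case (2 j)
      then show ?thesis
        using assms by (auto simp: rees_map_yv rees_algebra_def intro!: generate_ring.incl)
    qed
  next
    case (add p q)
    then show ?case
      using subringE(7)[OF rees_algebra_subring[OF assms]]
      by (simp add: rees_map_def psubst_add ring_xs_def)
  next
    case (mult p q)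
    then show ?case
      using subringE(6)[OF rees_algebra_subring[OF assms]]
      by (simp add: rees_map_def psubst_mult ring_xs_def)
  qed
qed (simp_all add: ring_xy_def rees_map_def psubst_add psubst_mult)

lemma rees_map_surj:
  assumes "n \<ge> 3"
  shows "rees_map n ` carrier (ring_xy n) =
    carrier (rees_algebra n :: (var, 'k :: comm_ring_1) mpoly ring)"
proof
  show "rees_map n ` carrier (ring_xy n) \<subseteq>
    carrier (rees_algebra n :: (var, 'k) mpoly ring)"
    using ring_hom_closed[OF rees_map_hom[OF assms]] by auto
next
  interpret T: cring "ring_xy n :: (var, 'k) mpoly ring" unfolding ring_xy_def by (rule poly_ring_cring)
  interpret Q: cring "ring_xs n :: (var, 'k) mpoly ring" unfolding ring_xs_def by (rule poly_ring_cring)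
  have neg: "\<ominus>\<^bsub>ring_xs n\<^esub> q = - q" if "q \<in> carrier (ring_xs n)" for q :: "(var, 'k) mpoly"
    by (rule Q.minus_equality)
      (use that in \<open>simp_all add: ring_xs_def uminus_in_carrier\<close>)
  have x_fixed: "rees_map n p = p \<and> p \<in> carrier (ring_xy n)" if "p \<in> carrier (ring_x n)"
    for p :: "(var, 'k) mpoly"
    using that unfolding ring_x_def
  proof (induction rule: poly_ring_induct)
    case (Var v)
    then show ?case
      by (auto simp: rees_map_def psubst_Var xv_def ring_xy_def Var_in_carrier)
  qed (simp_all add: rees_map_def psubst_Const psubst_add psubst_mult ring_xy_def
      Const_in_carrier add_in_carrier mult_in_carrier)
  have "q \<in> rees_map n ` carrier (ring_xy n)" if "q \<in> carrier (rees_algebra n)"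
    for q :: "(var, 'k) mpoly"
  proof -
    have "q \<in> generate_ring (ring_xs n)
        (carrier (ring_x n) \<union> {path_gen n j * sv | j. j \<in> {1..n}})"
      using that by (simp add: rees_algebra_def)
    then show ?thesis
    proof (induction rule: generate_ring.induct)
      case one
      show ?case by (rule image_eqI[of _ _ 1])
          (simp_all add: ring_xs_def ring_xy_def rees_map_def carrier_poly_ring[of 1])
    next
      case (incl g)
      show ?case
      proof (cases "g \<in> carrier (ring_x n)")
        case True
        then show ?thesis using x_fixed[of g] by (metis image_eqI)
      next
        case False
        then obtain j where "g = path_gen n j * sv" using incl by auto
        then show ?thesis using assms
          by (intro image_eqI[of _ _ "yv n j"])
            (simp add: rees_map_yv, simp add: ring_xy_def yv_def Var_in_carrier)
      qed
    next
      case (a_inv g)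
      then obtain p where p: "g = rees_map n p" "p \<in> carrier (ring_xy n)" by auto
      have "rees_map n (- p) + rees_map n p = 0"
        by (simp add: rees_map_def flip: psubst_add)
      then have "rees_map n (- p) = - g" by (simp add: p eq_neg_iff_add_eq_0)
      moreover have "g \<in> carrier (ring_xs n)"
        using Q.generate_ring_in_carrier[OF rees_gens_in_carrier[OF assms] a_inv.hyps] .
      ultimately show ?case using p neg
        by (intro image_eqI[of _ _ "- p"]) (simp_all add: ring_xy_def uminus_in_carrier)
    next
      case (eng_add g g')
      then obtain p p' where "g = rees_map n p" "p \<in> carrier (ring_xy n)"
        "g' = rees_map n p'" "p' \<in> carrier (ring_xy n)" by auto
      then show ?case by (intro image_eqI[of _ _ "p + p'"])
          (simp_all add: ring_xs_def ring_xy_def rees_map_def psubst_add add_in_carrier)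
    next
      case (eng_mult g g')
      then obtain p p' where "g = rees_map n p" "p \<in> carrier (ring_xy n)"
        "g' = rees_map n p'" "p' \<in> carrier (ring_xy n)" by auto
      then show ?case by (intro image_eqI[of _ _ "p * p'"])
          (simp_all add: ring_xs_def ring_xy_def rees_map_def psubst_mult mult_in_carrier)
    qed
  qed
  then show "carrier (rees_algebra n :: (var, 'k) mpoly ring) \<subseteq>
    rees_map n ` carrier (ring_xy n)" by blast
qed

end

theory Submission
  imports Defs
begin

text \<open>
  The map \<open>\<phi>\<close> sends monomials to monomials, so its kernel \<open>J\<close> is spanned by differences of
  monomials with the same image (\<open>monomial_kernel_in\<close>), and the problem is to connect any two
  monomials with the same image by steps whose differences lie in the claimed ideal.

  Write \<open>P = x\<^sub>1 \<cdots> x\<^sub>n\<close>. Since \<open>u\<^sub>j = P / (x\<^sub>j\<^sub>-\<^sub>2 x\<^sub>j\<^sub>-\<^sub>1)\<close>, the variable \<open>y\<^sub>j\<close> behaves like the edge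
  joining the vertices \<open>j - 2\<close> and \<open>j - 1\<close> of the cycle, with negative weight at its ends. Let two
  monomials with the same image have exponents \<open>(a, b)\<close> and \<open>(c, d)\<close> in \<open>(x, y)\<close>, and put
  \<open>\<delta> = b - d\<close>. Comparing the exponents of \<open>s\<close> and of the \<open>x\<^sub>i\<close> in the images gives
  \<open>\<Sum> \<delta>\<^sub>j = 0\<close> and \<open>a\<^sub>i - c\<^sub>i = \<delta>\<^sub>i\<^sub>+\<^sub>1 + \<delta>\<^sub>i\<^sub>+\<^sub>2\<close> (\<open>ydiff_relations\<close>). In particular \<open>\<delta> = 0\<close>
  forces equality, and the argument is an induction on \<open>\<Sum> \<bar>\<delta>\<^sub>j\<bar>\<close>.

  Three kinds of steps are available. The generator \<open>f\<^sub>j\<close> turns an edge about one of its ends,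
  \<open>x\<^sub>j\<^sub>-\<^sub>2 y\<^sub>j \<leftrightarrow> x\<^sub>j y\<^sub>j\<^sub>+\<^sub>1\<close>. Multiplying by \<open>x\<^sub>j\<^sub>-\<^sub>1\<close> and iterating shows that an edge whose two
  ends are both divisors can be exchanged for any other edge:
  \<open>x\<^sub>j\<^sub>-\<^sub>2 x\<^sub>j\<^sub>-\<^sub>1 y\<^sub>j \<equiv> x\<^sub>k\<^sub>-\<^sub>2 x\<^sub>k\<^sub>-\<^sub>1 y\<^sub>k\<close> modulo \<open>L\<close> for all \<open>j, k\<close> (\<open>edge_exchange\<close>). Finally, for even
  \<open>n\<close>, the generator \<open>h\<close> exchanges the two perfect matchings of the cycle.

  If \<open>\<delta>\<^sub>i\<^sub>+\<^sub>1 + \<delta>\<^sub>i\<^sub>+\<^sub>2 > 0\<close> for some \<open>i\<close>, then \<open>x\<^sub>i\<close> divides the first monomial and one of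
  \<open>\<delta>\<^sub>i\<^sub>+\<^sub>1, \<delta>\<^sub>i\<^sub>+\<^sub>2\<close> is positive. Either turning that edge moves it to a place where \<open>\<delta>\<close> is negative,
  or the neighbouring sum is positive too, so that both ends of the edge are divisors and it can be
  exchanged for any edge \<open>k\<close> with \<open>\<delta>\<^sub>k < 0\<close>. If no such sum is positive, all of them vanish because
  they add up to \<open>2 \<Sum> \<delta>\<^sub>j = 0\<close>. Then \<open>\<delta>\<close> alternates in sign around the cycle, which for odd
  \<open>n\<close> means \<open>\<delta> = 0\<close>, and for even \<open>n\<close> means that \<open>h\<close> applies (\<open>cyclic_sign_pattern\<close>). Every step
  lowers \<open>\<Sum> \<bar>\<delta>\<^sub>j\<bar>\<close>.
\<close>

section \<open>Kernels of monomial substitutions\<close>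

abbreviation mterm :: "('v \<Rightarrow>\<^sub>0 nat) \<Rightarrow> ('v, 'k :: comm_ring_1) mpoly" where
  "mterm m \<equiv> Poly_Mapping.single m 1"

lemma mterm_add: "mterm (a + b) = mterm a * mterm b"
  by (simp add: mult_single)

lemma mterm_sum: "mterm (\<Sum>i \<in> A. g i) = (\<Prod>i \<in> A. mterm (g i))"
  by (induction A rule: infinite_finite_induct) (simp_all add: mterm_add)

text \<open>
  When every variable \<open>v\<close> is replaced by the monomial with exponent \<open>\<tau> v\<close>, this is the exponent
  \<open>\<Sum> m\<^sub>v \<tau> v\<close> of the image of the monomial \<open>m\<close>. The inner sum stands for the multiple \<open>m\<^sub>v \<tau> v\<close>.
\<close>

definition image_exp :: "('v \<Rightarrow> 'w \<Rightarrow>\<^sub>0 nat) \<Rightarrow> ('v \<Rightarrow>\<^sub>0 nat) \<Rightarrow> 'w \<Rightarrow>\<^sub>0 nat" where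
  "image_exp \<tau> m = (\<Sum>v \<in> Poly_Mapping.keys m. \<Sum>_ < Poly_Mapping.lookup m v. \<tau> v)"

lemma mon_subst_monomial:
  "mon_subst (\<lambda>v. mterm (\<tau> v)) m = mterm (image_exp \<tau> m)"
  by (simp add: mon_subst_def image_exp_def mterm_sum)

lemma lookup_image_exp:
  assumes "finite A" "Poly_Mapping.keys m \<subseteq> A"
  shows "Poly_Mapping.lookup (image_exp \<tau> m) w =
    (\<Sum>v \<in> A. Poly_Mapping.lookup m v * Poly_Mapping.lookup (\<tau> v) w)"
proof -
  have "Poly_Mapping.lookup (image_exp \<tau> m) w =
      (\<Sum>v \<in> Poly_Mapping.keys m. Poly_Mapping.lookup m v * Poly_Mapping.lookup (\<tau> v) w)"
    by (simp add: image_exp_def lookup_sum)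
  also have "\<dots> = (\<Sum>v \<in> A. Poly_Mapping.lookup m v * Poly_Mapping.lookup (\<tau> v) w)"
    by (rule sum.mono_neutral_left) (use assms in \<open>auto simp: in_keys_iff\<close>)
  finally show ?thesis .
qed

lemma image_exp_add: "image_exp \<tau> (a + b) = image_exp \<tau> a + image_exp \<tau> b"
proof (rule poly_mapping_eqI)
  fix w
  let ?A = "Poly_Mapping.keys a \<union> Poly_Mapping.keys b"
  have "Poly_Mapping.keys (a + b) \<subseteq> ?A" by (rule keys_add)
  then show "Poly_Mapping.lookup (image_exp \<tau> (a + b)) w =
      Poly_Mapping.lookup (image_exp \<tau> a + image_exp \<tau> b) w"
    by (simp add: lookup_image_exp[of ?A] lookup_add distrib_right sum.distrib)
qed

lemma psubst_mterm: "psubst (\<lambda>v. mterm (\<tau> v)) (mterm m) = mterm (image_exp \<tau> m)"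
  by (simp add: psubst_single mon_subst_monomial Const_simps)

lemma lookup_psubst_monomial:
  "Poly_Mapping.lookup (psubst (\<lambda>v. mterm (\<tau> v)) p) w =
    (\<Sum>m \<in> Poly_Mapping.keys p. Poly_Mapping.lookup p m when image_exp \<tau> m = w)"
  by (simp add: psubst_def mon_subst_monomial Const_def mult_single lookup_sum lookup_single)

lemma psubst_diff: "psubst \<sigma> (p - q) = psubst \<sigma> p - psubst \<sigma> q"
  by (metis add_diff_cancel_right' diff_add_cancel psubst_add)

text \<open>
  If \<open>p\<close> is mapped to zero, the image of each of its monomials \<open>m\<close> must be cancelled by the image
  of another one, \<open>m'\<close>. Subtracting the right multiple of \<open>m - m'\<close> removes \<open>m\<close> from \<open>p\<close> without
  introducing new monomials.
\<close>

lemma monomial_kernel_in: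
  fixes p :: "('v, 'k :: comm_ring_1) mpoly"
  assumes "psubst (\<lambda>v. mterm (\<tau> v)) p = 0"
    and "0 \<in> M"
    and add: "\<And>q r. q \<in> M \<Longrightarrow> r \<in> M \<Longrightarrow> q + r \<in> M"
    and smult: "\<And>c q. q \<in> M \<Longrightarrow> Const c * q \<in> M"
    and diff: "\<And>m m'. \<lbrakk>m \<in> Poly_Mapping.keys p; m' \<in> Poly_Mapping.keys p;
      image_exp \<tau> m = image_exp \<tau> m'\<rbrakk> \<Longrightarrow> mterm m - mterm m' \<in> M"
  shows "p \<in> M"
  using assms(1) diff
proof (induction "card (Poly_Mapping.keys p)" arbitrary: p rule: less_induct)
  case less
  show ?case
  proof (cases "p = 0")
    case True
    then show ?thesis using assms(2) by simp
  next
    case False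
    then obtain m where m: "m \<in> Poly_Mapping.keys p" by (metis all_not_in_conv keys_eq_empty)
    have "\<exists>m' \<in> Poly_Mapping.keys p. m' \<noteq> m \<and> image_exp \<tau> m = image_exp \<tau> m'"
    proof (rule ccontr)
      assume no: "\<not> (\<exists>m' \<in> Poly_Mapping.keys p. m' \<noteq> m \<and> image_exp \<tau> m = image_exp \<tau> m')"
      have "0 = (\<Sum>k \<in> Poly_Mapping.keys p.
          Poly_Mapping.lookup p k when image_exp \<tau> k = image_exp \<tau> m)"
        using lookup_psubst_monomial[of \<tau> p "image_exp \<tau> m"] less.prems(1) by simp
      also have "\<dots> = (\<Sum>k \<in> Poly_Mapping.keys p. Poly_Mapping.lookup p k when k = m)"
        by (rule sum.cong[OF refl]) (use no in \<open>auto simp: when_def\<close>)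
      also have "\<dots> = Poly_Mapping.lookup p m"
        using m by (simp add: when_def)
      finally show False using m by (simp add: in_keys_iff)
    qed
    then obtain m' where m': "m' \<in> Poly_Mapping.keys p" "m' \<noteq> m"
      "image_exp \<tau> m = image_exp \<tau> m'" by blast
    define c where "c = Poly_Mapping.lookup p m"
    define q where "q = p - Const c * (mterm m - mterm m')"
    have q_eq: "q = p - Poly_Mapping.single m c + Poly_Mapping.single m' c"
      by (simp add: q_def Const_def mult_single right_diff_distrib)
    have keys_q: "Poly_Mapping.keys q \<subseteq> Poly_Mapping.keys p - {m}"
      using m m' by (auto simp: q_eq in_keys_iff lookup_add lookup_minus lookup_single c_def when_def
          split: if_splits)
    have "card (Poly_Mapping.keys q) < card (Poly_Mapping.keys p)"
      using keys_q m by (intro psubset_card_mono) auto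
    moreover have "psubst (\<lambda>v. mterm (\<tau> v)) q = 0"
      using less.prems(1) m' by (simp add: q_def psubst_diff psubst_mult psubst_mterm)
    moreover have "mterm k - mterm k' \<in> M" if "k \<in> Poly_Mapping.keys q" "k' \<in> Poly_Mapping.keys q"
        "image_exp \<tau> k = image_exp \<tau> k'" for k k'
      using less.prems(2) that keys_q by blast
    ultimately have "q \<in> M" by (rule less.hyps)
    moreover have "p = q + Const c * (mterm m - mterm m')" by (simp add: q_def)
    ultimately show ?thesis using add smult less.prems(2) m m' by metis
  qed
qed

section \<open>Exponents of the Rees map\<close>

definition xe :: "nat \<Rightarrow> nat \<Rightarrow> var \<Rightarrow>\<^sub>0 nat" where
  "xe n i = Poly_Mapping.single (XVar (i mod n)) 1"

definition ye :: "nat \<Rightarrow> nat \<Rightarrow> var \<Rightarrow>\<^sub>0 nat" where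
  "ye n j = Poly_Mapping.single (YVar (j mod n)) 1"

definition rees_exp :: "nat \<Rightarrow> var \<Rightarrow> var \<Rightarrow>\<^sub>0 nat" where
  "rees_exp n v = (case v of XVar i \<Rightarrow> xe n i
     | YVar j \<Rightarrow> (\<Sum>i = j..j + n - 3. xe n i) + Poly_Mapping.single SVar 1
     | SVar \<Rightarrow> Poly_Mapping.single SVar 1)"

lemma xv_eq: "xv n i = mterm (xe n i)" and yv_eq: "yv n j = mterm (ye n j)"
  by (simp_all add: xv_def yv_def Var_def xe_def ye_def)

lemma rees_map_eq: "rees_map n = psubst (\<lambda>v. mterm (rees_exp n v))"
  unfolding rees_map_def
  by (rule arg_cong[of _ _ psubst])
    (auto simp: fun_eq_iff rees_exp_def xv_eq path_gen_def sv_def Var_def mterm_add mterm_sum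
      simp del: One_nat_def split: var.split)

lemma sum_full_cycle: "(\<Sum>i = j..<j + n. xe n i) = (\<Sum>i < n. xe n i)"
proof (induction j)
  case 0
  show ?case by (simp add: atLeast0LessThan)
next
  case (Suc j)
  have "(\<Sum>i = j..<Suc (j + n). xe n i) = xe n j + (\<Sum>i = Suc j..<Suc j + n. xe n i)"
    by (subst sum.atLeast_Suc_lessThan) auto
  moreover have "(\<Sum>i = j..<Suc (j + n). xe n i) = (\<Sum>i = j..<j + n. xe n i) + xe n j"
    by (simp add: xe_def)
  ultimately show ?case using Suc by (simp add: add.commute)
qed

text \<open>
  The identity \<open>u\<^sub>j x\<^sub>j\<^sub>-\<^sub>2 x\<^sub>j\<^sub>-\<^sub>1 s = P s\<close> in terms of exponents. It replaces the description of \<open>u\<^sub>j\<close>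
  as a path on \<open>n - 2\<close> vertices by that of the missing edge. Subtraction of exponents is avoided by
  adding the edge; \<open>n - 2 + j\<close> is \<open>j - 2\<close> modulo \<open>n\<close>.
\<close>

lemma rees_exp_complement:
  assumes "n \<ge> 3"
  shows "rees_exp n (YVar j) + xe n (n - 2 + j) + xe n (n - 1 + j) =
    (\<Sum>i < n. xe n i) + Poly_Mapping.single SVar 1"
proof -
  obtain k where k: "n = k + 3" using assms by (metis add.commute le_add_diff_inverse)
  have "{j..<j + n} = {j..<Suc (Suc (Suc (j + k)))}" "{j..j + n - 3} = {j..<Suc (j + k)}"
    by (auto simp: k)
  then have "(\<Sum>i = j..<j + n. xe n i) =
      xe n (n - 1 + j) + (xe n (n - 2 + j) + (\<Sum>i = j..j + n - 3. xe n i))"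
    by (simp add: k add_ac numeral_2_eq_2)
  then show ?thesis
    unfolding sum_full_cycle by (simp add: rees_exp_def add_ac del: One_nat_def)
qed

lemma image_exp_xe: "image_exp (rees_exp n) (xe n i) = xe n i"
  by (simp add: image_exp_def xe_def rees_exp_def)

lemma image_exp_ye:
  assumes "n \<ge> 3"
  shows "image_exp (rees_exp n) (ye n j) + xe n (n - 2 + j) + xe n (n - 1 + j) =
    (\<Sum>i < n. xe n i) + Poly_Mapping.single SVar 1"
proof -
  have "xe n (k + j mod n) = xe n (k + j)" for k by (simp add: xe_def mod_add_right_eq)
  then show ?thesis using rees_exp_complement[OF assms, of "j mod n"]
    by (simp add: image_exp_def ye_def)
qed

lemma image_exp_sum: "image_exp \<tau> (\<Sum>i \<in> A. g i) = (\<Sum>i \<in> A. image_exp \<tau> (g i))"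
  by (induction A rule: infinite_finite_induct) (simp_all add: image_exp_add, simp_all add: image_exp_def)

definition even_ys :: "nat \<Rightarrow> var \<Rightarrow>\<^sub>0 nat" where
  "even_ys n = (\<Sum>i = 0..n div 2 - 1. ye n (2 * i))"

definition odd_ys :: "nat \<Rightarrow> var \<Rightarrow>\<^sub>0 nat" where
  "odd_ys n = (\<Sum>i = 0..n div 2 - 1. ye n (2 * i + 1))"

lemma xe_periodic: "xe n (n + i) = xe n i" by (simp add: xe_def)

lemma f_gen_eq: "f_gen n j = mterm (xe n (n - 2 + j) + ye n j) - mterm (xe n j + ye n (j + 1))"
  by (simp add: f_gen_def xv_eq yv_eq mterm_add)

lemma h_gen_eq: "h_gen n = mterm (even_ys n) - mterm (odd_ys n)"
  by (simp add: h_gen_def yv_eq even_ys_def odd_ys_def mterm_sum)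

text \<open>The edges missing from \<open>u\<^sub>j\<close> and \<open>u\<^sub>j\<^sub>+\<^sub>1\<close> share the vertex \<open>j - 1\<close>, which cancels.\<close>

lemma image_exp_f_gen:
  assumes "n \<ge> 3"
  shows "image_exp (rees_exp n) (xe n (n - 2 + j) + ye n j) =
    image_exp (rees_exp n) (xe n j + ye n (j + 1))"
proof -
  have idx: "n - 2 + (j + 1) = n - 1 + j" "n - 1 + (j + 1) = n + j" using assms by auto
  have "image_exp (rees_exp n) (ye n j) + xe n (n - 2 + j) + xe n (n - 1 + j) =
      image_exp (rees_exp n) (ye n (j + 1)) + xe n (n - 1 + j) + xe n j"
    using image_exp_ye[OF assms, of j] image_exp_ye[OF assms, of "j + 1"]
    unfolding idx xe_periodic by simp
  also have "\<dots> = image_exp (rees_exp n) (ye n (j + 1)) + xe n j + xe n (n - 1 + j)"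
    by (simp only: add_ac)
  finally have "image_exp (rees_exp n) (ye n j) + xe n (n - 2 + j) =
      image_exp (rees_exp n) (ye n (j + 1)) + xe n j"
    by (simp only: add_right_cancel)
  then show ?thesis by (simp only: image_exp_add image_exp_xe add.commute)
qed

text \<open>
  The edges with even index cover every vertex of an even cycle exactly once, and so do those with
  odd index. Hence either product of \<open>y\<close>-variables, multiplied by \<open>P\<close>, is mapped to
  \<open>(P s)\<close> to the power \<open>n / 2\<close>.
\<close>

lemma image_exp_h_gen:
  assumes "n \<ge> 3" "even n"
  shows "image_exp (rees_exp n) (even_ys n) = image_exp (rees_exp n) (odd_ys n)"
proof -
  let ?I = "{0..n div 2 - 1}" and ?\<mu> = "image_exp (rees_exp n)"
  let ?C = "(\<Sum>i < n. xe n i) + Poly_Mapping.single SVar 1"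
  define l where "l = n div 2"
  have n: "n = 2 * l" "l \<ge> 2" using assms by (auto simp: l_def)
  have pairs: "(\<Sum>i \<in> ?I. xe n (k + 2 * i) + xe n (Suc k + 2 * i)) = (\<Sum>i < n. xe n i)" for k
  proof -
    have I: "?I = {..<l}" using n by auto
    have "(\<Sum>i < m. xe n (k + 2 * i) + xe n (Suc k + 2 * i)) = (\<Sum>i = k..<k + 2 * m. xe n i)" for m
      by (induction m) (simp_all add: add_ac)
    from this[of l] show ?thesis using sum_full_cycle[of n k] unfolding I n(1)[symmetric] by simp
  qed
  have suc: "n - 1 = Suc (n - 2)" using n by auto
  have idx: "n - 2 + (2 * i + 1) = n - 1 + 2 * i" "n - 1 + (2 * i + 1) = Suc (n - 1) + 2 * i" for i
    using n by auto
  have "?\<mu> (even_ys n) + (\<Sum>i < n. xe n i) =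
      (\<Sum>i \<in> ?I. ?\<mu> (ye n (2 * i)) + xe n (n - 2 + 2 * i) + xe n (n - 1 + 2 * i))"
    using pairs[of "n - 2"] by (simp only: even_ys_def image_exp_sum sum.distrib suc add.assoc)
  also have "\<dots> = (\<Sum>i \<in> ?I. ?C)" by (simp only: image_exp_ye[OF assms(1)])
  also have "\<dots> = (\<Sum>i \<in> ?I. ?\<mu> (ye n (2 * i + 1)) + xe n (n - 2 + (2 * i + 1)) + xe n (n - 1 + (2 * i + 1)))"
    by (simp only: image_exp_ye[OF assms(1)])
  also have "\<dots> = ?\<mu> (odd_ys n) + (\<Sum>i < n. xe n i)"
    using pairs[of "n - 1"] by (simp only: idx odd_ys_def image_exp_sum sum.distrib add.assoc)
  finally show ?thesis by simp
qed


section \<open>Exponent differences around the cycle\<close>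

text \<open>
  The four cases are the situations in which turning an edge forwards, turning it backwards,
  exchanging it for an arbitrary one, or applying \<open>h\<close> reduces the difference \<open>\<delta>\<close> of two monomials
  with the same image. In the first three, \<open>\<delta> (i + 1) + \<delta> (i + 2) > 0\<close> makes \<open>x\<^sub>i\<close> a divisor of the
  first monomial.
\<close>

lemma cyclic_sign_pattern:
  fixes \<delta> :: "nat \<Rightarrow> int"
  assumes "n > 0"
    and per: "\<And>i. \<delta> (i + n) = \<delta> i"
    and sum0: "(\<Sum>i < n. \<delta> i) = 0"
    and neg: "\<delta> k < 0"
  obtains (forward) i where "\<delta> (i + 1) + \<delta> (i + 2) > 0" "\<delta> (i + 2) > 0" "\<delta> (i + 3) < 0"
  | (backward) i where "\<delta> (i + 1) + \<delta> (i + 2) > 0" "\<delta> (i + 1) > 0" "\<delta> i < 0"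
  | (jump) i where "\<delta> (i + 1) + \<delta> (i + 2) > 0" "\<delta> (i + 2) > 0" "\<delta> (i + 2) + \<delta> (i + 3) > 0"
  | (alternating) "even n" "\<delta> 0 \<noteq> 0" "\<And>i. \<delta> i = (if even i then \<delta> 0 else - \<delta> 0)"
proof (cases "\<exists>i. \<delta> (i + 1) + \<delta> (i + 2) > 0")
  case True
  then obtain i where i: "\<delta> (i + 1) + \<delta> (i + 2) > 0" by blast
  show thesis
  proof (cases "\<delta> (i + 2) > 0")
    case True
    show thesis
    proof (cases "\<delta> (i + 3) < 0")
      case False
      then show thesis using i True by (intro jump) auto
    qed (use i True forward in blast)
  next
    case False
    then have pos: "\<delta> (i + 1) > 0" using i by simp
    show thesis
    proof (cases "\<delta> i < 0")
      case False
      \<comment> \<open>The edge \<open>i + 1\<close> has both ends among the divisors; \<open>i + n - 1\<close> is the index \<open>i - 1\<close>.\<close>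
      have "i + n - 1 + 1 = i + n" "i + n - 1 + 2 = (i + 1) + n" "i + n - 1 + 3 = (i + 2) + n"
        using assms(1) by auto
      then have "\<delta> (i + n - 1 + 1) = \<delta> i" "\<delta> (i + n - 1 + 2) = \<delta> (i + 1)"
        "\<delta> (i + n - 1 + 3) = \<delta> (i + 2)" by (simp_all only: per)
      moreover have "\<delta> i + \<delta> (i + 1) > 0" using pos False by simp
      ultimately show thesis using i pos jump[of "i + n - 1"] by presburger
    qed (use i pos backward in blast)
  qed
next
  case False
  define s where "s i = \<delta> (i + 1) + \<delta> (i + 2)" for i
  have shift: "(\<Sum>i < n. \<delta> (i + j)) = 0" for j
  proof (induction j)
    case (Suc j)
    have "(\<Sum>i < Suc n. \<delta> (i + j)) = \<delta> j + (\<Sum>i < n. \<delta> (i + Suc j))"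
      by (subst sum.lessThan_Suc_shift) simp
    moreover have "\<delta> (n + j) = \<delta> j" using per[of j] by (simp add: add.commute)
    ultimately show ?case using Suc by simp
  qed (simp add: sum0)
  have "(\<Sum>i < n. - s i) = 0"
    using shift[of 1] shift[of 2] unfolding s_def sum_negf sum.distrib by (simp only:)
  moreover have nonneg: "- s i \<ge> 0" for i
  proof -
    have "\<not> \<delta> (i + 1) + \<delta> (i + 2) > 0" using False by blast
    then show ?thesis by (simp add: s_def)
  qed
  ultimately have s0: "s i = 0" if "i < n" for i
    using that sum_nonneg_eq_0_iff[of "{..<n}" "\<lambda>i. - s i"] by auto
  have step: "\<delta> (Suc i) = - \<delta> i" if "i < n" for i
  proof (cases i)
    case 0
    \<comment> \<open>The sum \<open>\<delta> 0 + \<delta> 1\<close> would be \<open>s\<close> at \<open>-1\<close>; modulo \<open>n\<close> it is \<open>s (n - 1)\<close>.\<close>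
    have "n - 1 + 1 = 0 + n" "n - 1 + 2 = 1 + n" using assms(1) by auto
    then have "s (n - 1) = \<delta> 0 + \<delta> 1" by (simp only: s_def per)
    then show ?thesis using s0[of "n - 1"] assms(1) 0 by simp
  next
    case (Suc l)
    then show ?thesis using s0[of l] that by (simp add: s_def)
  qed
  have fin: "i \<le> n \<Longrightarrow> \<delta> i = (if even i then \<delta> 0 else - \<delta> 0)" for i
    by (induction i) (auto simp: step)
  have per_mod: "\<delta> i = \<delta> (i mod n)" for i
  proof -
    have "\<delta> (i + n * q) = \<delta> i" for i q
    proof (induction q)
      case (Suc q)
      have "i + n * Suc q = (i + n * q) + n" by simp
      then show ?case using Suc per by metis
    qed simp
    from this[of "i mod n" "i div n"] show ?thesis by simp
  qed
  have "\<delta> 0 \<noteq> 0" using neg per_mod[of k] fin[of "k mod n"] assms(1) by (auto simp: less_imp_le split: if_splits)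
  moreover have ev: "even n" using fin[of n] per[of 0] calculation by (auto split: if_splits)
  moreover have "\<delta> i = (if even i then \<delta> 0 else - \<delta> 0)" for i
    using per_mod[of i] fin[of "i mod n"] assms(1) ev by (simp add: less_imp_le dvd_mod_iff)
  ultimately show thesis using alternating by blast
qed

abbreviation xy_mon :: "nat \<Rightarrow> (var \<Rightarrow>\<^sub>0 nat) \<Rightarrow> bool" where
  "xy_mon n m \<equiv> Poly_Mapping.keys m \<subseteq> XVar ` {..<n} \<union> YVar ` {..<n}"

definition ydiff :: "nat \<Rightarrow> (var \<Rightarrow>\<^sub>0 nat) \<Rightarrow> (var \<Rightarrow>\<^sub>0 nat) \<Rightarrow> nat \<Rightarrow> int" where
  "ydiff n m m' j = int (Poly_Mapping.lookup m (YVar (j mod n)))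
    - int (Poly_Mapping.lookup m' (YVar (j mod n)))"

lemma lookup_xe: "Poly_Mapping.lookup (xe n i) v = of_bool (v = XVar (i mod n))"
  and lookup_ye: "Poly_Mapping.lookup (ye n j) v = of_bool (v = YVar (j mod n))"
  by (auto simp: xe_def ye_def lookup_single when_def)

lemma lookup_image_exp_xy:
  assumes "n > 0" "xy_mon n m"
  shows "Poly_Mapping.lookup (image_exp (rees_exp n) m) w =
    (\<Sum>i < n. Poly_Mapping.lookup m (XVar i) * Poly_Mapping.lookup (rees_exp n (XVar i)) w) +
    (\<Sum>j < n. Poly_Mapping.lookup m (YVar j) * Poly_Mapping.lookup (rees_exp n (YVar j)) w)"
proof -
  have "finite (XVar ` {..<n} \<union> YVar ` {..<n})" by simp
  from lookup_image_exp[OF this assms(2)] show ?thesis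
    by (subst (asm) sum.union_disjoint) (auto simp: sum.reindex inj_on_def)
qed

lemma lookup_image_SVar:
  assumes "n > 0" "xy_mon n m"
  shows "Poly_Mapping.lookup (image_exp (rees_exp n) m) SVar =
    (\<Sum>j < n. Poly_Mapping.lookup m (YVar j))"
  using assms
  by (simp add: lookup_image_exp_xy rees_exp_def lookup_add lookup_sum lookup_xe)

text \<open>
  The image of \<open>y\<^sub>j\<close> is divisible by \<open>x\<^sub>i\<close> exactly once, unless \<open>i\<close> is an end of the edge \<open>j\<close>, and the
  edges that end in \<open>i\<close> are \<open>i + 1\<close> and \<open>i + 2\<close>.
\<close>

lemma lookup_image_XVar:
  assumes "n \<ge> 3" "xy_mon n m" "i < n"
  shows "Poly_Mapping.lookup (image_exp (rees_exp n) m) (XVar i)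
      + Poly_Mapping.lookup m (YVar ((i + 2) mod n)) + Poly_Mapping.lookup m (YVar ((i + 1) mod n)) =
    Poly_Mapping.lookup m (XVar i) + (\<Sum>j < n. Poly_Mapping.lookup m (YVar j))"
proof -
  let ?b = "\<lambda>j. Poly_Mapping.lookup m (YVar j)"
  let ?r = "\<lambda>j. Poly_Mapping.lookup (rees_exp n (YVar j)) (XVar i)"
  have r: "?r j + of_bool (i = (n - 2 + j) mod n) + of_bool (i = (n - 1 + j) mod n) = 1" for j
  proof -
    have "(\<Sum>l < n. of_bool (i = l mod n)) = (\<Sum>l < n. of_bool (l = i) :: nat)"
      by (rule sum.cong) auto
    then show ?thesis
      using arg_cong[OF rees_exp_complement[OF assms(1), of j], of "\<lambda>e. Poly_Mapping.lookup e (XVar i)"] assms(3)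
      by (simp add: lookup_add lookup_sum lookup_xe lookup_single)
  qed
  have solve: "i = (n - c + j) mod n \<longleftrightarrow> j = (i + c) mod n" if "j < n" "c \<le> n" for j c
  proof
    assume "i = (n - c + j) mod n"
    then have "(i + c) mod n = (n - c + j + c) mod n" by (simp add: mod_add_left_eq)
    also have "n - c + j + c = n + j" using that by simp
    finally show "j = (i + c) mod n" using that by simp
  next
    assume "j = (i + c) mod n"
    then have "(n - c + j) mod n = (n - c + (i + c)) mod n" by (simp add: mod_add_right_eq)
    also have "n - c + (i + c) = n + i" using that by simp
    finally show "i = (n - c + j) mod n" using assms(3) by simp
  qed
  have pick: "(\<Sum>j < n. ?b j * of_bool (i = (n - c + j) mod n)) = ?b ((i + c) mod n)" if "c \<le> n" for c
  proof -
    have "(\<Sum>j < n. ?b j * of_bool (i = (n - c + j) mod n)) =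
        (\<Sum>j < n. if j = (i + c) mod n then ?b j else 0)"
    proof (rule sum.cong)
      fix j assume "j \<in> {..<n}"
      then have "i = (n - c + j) mod n \<longleftrightarrow> j = (i + c) mod n" by (intro solve that) simp
      then show "?b j * of_bool (i = (n - c + j) mod n) = (if j = (i + c) mod n then ?b j else 0)"
        by (simp only:) simp
    qed simp
    then show ?thesis using assms by simp
  qed
  have x: "(\<Sum>l < n. Poly_Mapping.lookup m (XVar l) * Poly_Mapping.lookup (rees_exp n (XVar l)) (XVar i)) =
      Poly_Mapping.lookup m (XVar i)"
  proof -
    have "(\<Sum>l < n. Poly_Mapping.lookup m (XVar l) * Poly_Mapping.lookup (rees_exp n (XVar l)) (XVar i)) =
        (\<Sum>l < n. if l = i then Poly_Mapping.lookup m (XVar l) else 0)"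
      by (rule sum.cong) (auto simp: rees_exp_def lookup_xe)
    then show ?thesis using assms(3) by simp
  qed
  have "(\<Sum>j < n. ?b j * ?r j) + ?b ((i + 2) mod n) + ?b ((i + 1) mod n) =
      (\<Sum>j < n. ?b j * (?r j + of_bool (i = (n - 2 + j) mod n) + of_bool (i = (n - 1 + j) mod n)))"
    using pick[of 2] pick[of 1] assms(1) by (simp only: distrib_left sum.distrib)
  also have "\<dots> = (\<Sum>j < n. ?b j)" by (simp only: r mult_1_right)
  finally show ?thesis
    using lookup_image_exp_xy[of n m "XVar i"] assms x by simp
qed

lemma ydiff_relations:
  assumes "n \<ge> 3" "xy_mon n m" "xy_mon n m'"
    and "image_exp (rees_exp n) m = image_exp (rees_exp n) m'"
  shows "(\<Sum>j < n. ydiff n m m' j) = 0"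
    and "int (Poly_Mapping.lookup m (XVar (i mod n))) - int (Poly_Mapping.lookup m' (XVar (i mod n))) =
      ydiff n m m' (i + 1) + ydiff n m m' (i + 2)"
proof -
  have s: "(\<Sum>j < n. Poly_Mapping.lookup m (YVar j)) = (\<Sum>j < n. Poly_Mapping.lookup m' (YVar j))"
    using lookup_image_SVar[of n m] lookup_image_SVar[of n m'] assms by simp
  then have "(\<Sum>j < n. int (Poly_Mapping.lookup m (YVar j))) = (\<Sum>j < n. int (Poly_Mapping.lookup m' (YVar j)))"
    by (simp flip: of_nat_sum)
  then show "(\<Sum>j < n. ydiff n m m' j) = 0" by (simp add: ydiff_def sum_subtractf)
  have "(i mod n + 1) mod n = (i + 1) mod n" "(i mod n + 2) mod n = (i + 2) mod n"
    by (simp_all only: mod_add_left_eq)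
  then show "int (Poly_Mapping.lookup m (XVar (i mod n))) - int (Poly_Mapping.lookup m' (XVar (i mod n))) =
      ydiff n m m' (i + 1) + ydiff n m m' (i + 2)"
    using lookup_image_XVar[OF assms(1,2), of "i mod n"] lookup_image_XVar[OF assms(1,3), of "i mod n"]
      assms(1,4) s unfolding ydiff_def by (simp only:) simp
qed

lemma
  assumes "even n" "n \<ge> 2" "j < n"
  shows lookup_even_ys: "Poly_Mapping.lookup (even_ys n) (YVar j) = of_bool (even j)"
    and lookup_odd_ys: "Poly_Mapping.lookup (odd_ys n) (YVar j) = of_bool (odd j)"
proof -
  have md: "2 * i mod n = 2 * i" "Suc (2 * i) mod n = Suc (2 * i)" if "i \<in> {0..n div 2 - 1}" for i
    using that assms by (auto elim!: evenE)
  have "Poly_Mapping.lookup (even_ys n) (YVar j) = (\<Sum>i = 0..n div 2 - 1. if i = j div 2 then of_bool (even j) else 0)"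
    unfolding even_ys_def lookup_sum lookup_ye by (rule sum.cong) (auto simp: md elim!: oddE)
  then show "Poly_Mapping.lookup (even_ys n) (YVar j) = of_bool (even j)" using assms by (auto elim!: evenE)
  have "Poly_Mapping.lookup (odd_ys n) (YVar j) = (\<Sum>i = 0..n div 2 - 1. if i = j div 2 then of_bool (odd j) else 0)"
    unfolding odd_ys_def lookup_sum lookup_ye by (rule sum.cong) (auto simp: md elim!: oddE)
  then show "Poly_Mapping.lookup (odd_ys n) (YVar j) = of_bool (odd j)" using assms by (auto elim!: evenE oddE)
qed


section \<open>Connecting monomials with the same image\<close>

lemma ring_xy_ops [simp]:
  "p \<otimes>\<^bsub>ring_xy n\<^esub> q = p * q" "p \<oplus>\<^bsub>ring_xy n\<^esub> q = p + q"
  "\<one>\<^bsub>ring_xy n\<^esub> = 1" "\<zero>\<^bsub>ring_xy n\<^esub> = 0"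
  by (simp_all add: ring_xy_def)

lemma ring_xy_cring: "cring (ring_xy n :: (var, 'k :: comm_ring_1) mpoly ring)"
  unfolding ring_xy_def by (rule poly_ring_cring)

lemma ideal_xy_closed:
  fixes M :: "(var, 'k :: comm_ring_1) mpoly set"
  assumes "ideal M (ring_xy n)"
  shows ideal_xy_zero: "0 \<in> M"
    and ideal_xy_add: "p \<in> M \<Longrightarrow> q \<in> M \<Longrightarrow> p + q \<in> M"
    and ideal_xy_mult: "r \<in> carrier (ring_xy n) \<Longrightarrow> p \<in> M \<Longrightarrow> r * p \<in> M"
    and ideal_xy_uminus: "p \<in> M \<Longrightarrow> - p \<in> M"
proof -
  interpret I: ideal M "ring_xy n" by fact
  show "0 \<in> M" using additive_subgroup.zero_closed[OF I.additive_subgroup_axioms] by simp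
  show "p \<in> M \<Longrightarrow> q \<in> M \<Longrightarrow> p + q \<in> M" using additive_subgroup.a_closed[OF I.additive_subgroup_axioms, of p q] by simp
  show mult: "r \<in> carrier (ring_xy n) \<Longrightarrow> p \<in> M \<Longrightarrow> r * p \<in> M" for r using I.I_l_closed[of p r] by simp
  have "- 1 \<in> carrier (ring_xy n :: (var, 'k) mpoly ring)"
    by (simp add: ring_xy_def uminus_in_carrier carrier_poly_ring[of 1])
  then show "p \<in> M \<Longrightarrow> - p \<in> M" using mult[of "- 1"] by simp
qed

lemma mterm_in_ring_xy: "mterm m \<in> carrier (ring_xy n :: (var, 'k :: comm_ring_1) mpoly ring) \<longleftrightarrow> xy_mon n m"
  by (simp add: ring_xy_def carrier_poly_ring)

lemma xy_mon_add: "xy_mon n a \<Longrightarrow> xy_mon n b \<Longrightarrow> xy_mon n (a + b)"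
  using keys_add[of a b] by blast

lemma xy_mon_xe_ye: "n > 0 \<Longrightarrow> xy_mon n (xe n i)" "n > 0 \<Longrightarrow> xy_mon n (ye n i)"
  by (auto simp: xe_def ye_def)

lemma xy_mon_sum: "(\<And>i. i \<in> A \<Longrightarrow> xy_mon n (g i)) \<Longrightarrow> xy_mon n (\<Sum>i \<in> A. g i)"
  by (induction A rule: infinite_finite_induct) (simp_all add: xy_mon_add)

lemma move_in_ideal:
  fixes M :: "(var, 'k :: comm_ring_1) mpoly set"
  assumes "ideal M (ring_xy n)" "xy_mon n m" "mterm t - mterm t' \<in> M"
    and le: "\<And>v. Poly_Mapping.lookup t v \<le> Poly_Mapping.lookup m v"
  shows "mterm m - mterm (m - t + t') \<in> M"
proof -
  have m: "m = (m - t) + t" by (rule poly_mapping_eqI) (simp add: lookup_add lookup_minus le)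
  have "Poly_Mapping.keys (m - t) \<subseteq> Poly_Mapping.keys m"
    by (auto simp: in_keys_iff lookup_minus)
  then have "mterm (m - t) \<in> carrier (ring_xy n :: (var, 'k) mpoly ring)"
    using assms(2) by (simp only: mterm_in_ring_xy)
  then have "mterm (m - t) * (mterm t - mterm t') \<in> M"
    by (rule ideal_xy_mult[OF assms(1)]) (rule assms(3))
  moreover have "mterm (m - t) * (mterm t - mterm t') = (mterm m - mterm (m - t + t') :: (var, 'k) mpoly)"
    using m by (simp add: right_diff_distrib flip: mterm_add)
  ultimately show ?thesis by simp
qed

text \<open>
  It is enough to pass from \<open>j\<close> to \<open>j + 1\<close>, and
  \<open>x\<^sub>j\<^sub>-\<^sub>2 x\<^sub>j\<^sub>-\<^sub>1 y\<^sub>j - x\<^sub>j\<^sub>-\<^sub>1 x\<^sub>j y\<^sub>j\<^sub>+\<^sub>1 = x\<^sub>j\<^sub>-\<^sub>1 f\<^sub>j\<close>.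
\<close>

lemma edge_exchange:
  fixes M :: "(var, 'k :: comm_ring_1) mpoly set"
  assumes "n \<ge> 3" "ideal M (ring_xy n)" and f: "\<And>j. f_gen n j \<in> M"
  shows "mterm (xe n (n - 2 + j) + xe n (n - 1 + j) + ye n j) -
    mterm (xe n (n - 2 + k) + xe n (n - 1 + k) + ye n k) \<in> M"
proof -
  define g :: "nat \<Rightarrow> (var, 'k) mpoly"
    where "g j = mterm (xe n (n - 2 + j) + xe n (n - 1 + j) + ye n j)" for j
  have step: "g j - g (Suc j) \<in> M" for j
  proof -
    have "xe n (n - 2 + Suc j) = xe n (n - 1 + j)" "xe n (n - 1 + Suc j) = xe n j"
      using assms(1) xe_periodic[of n j] by (auto intro: arg_cong[of _ _ "xe n"])
    then have "g j - g (Suc j) = mterm (xe n (n - 1 + j)) * f_gen n j"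
      by (simp add: g_def f_gen_eq right_diff_distrib add_ac flip: mterm_add)
    then show ?thesis
      using ideal_xy_mult[OF assms(2) _ f] assms(1)
      by (metis mterm_in_ring_xy xy_mon_xe_ye(1) less_le_trans zero_less_numeral)
  qed
  have "g 0 - g j \<in> M" for j
  proof (induction j)
    case (Suc j)
    then show ?case using ideal_xy_add[OF assms(2) Suc step[of j]] by simp
  qed (simp add: ideal_xy_zero[OF assms(2)])
  then have "- (g 0 - g j) + (g 0 - g k) \<in> M"
    by (intro ideal_xy_add[OF assms(2)] ideal_xy_uminus[OF assms(2)])
  then show ?thesis by (simp add: g_def)
qed

text \<open>
  The combinatorial core: induction on \<open>\<Sum> \<bar>\<delta>\<^sub>j\<bar>\<close>, each step being one of the moves found by
  \<open>cyclic_sign_pattern\<close>. That \<open>M\<close> is mapped to zero guarantees that a move does not change the image.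
\<close>

lemma same_image_difference_in_ideal:
  fixes M :: "(var, 'k :: comm_ring_1) mpoly set"
  assumes n: "n \<ge> 3" and M: "ideal M (ring_xy n)"
    and f: "\<And>j. f_gen n j \<in> M" and h: "even n \<Longrightarrow> h_gen n \<in> M"
    and ker: "\<And>p. p \<in> M \<Longrightarrow> rees_map n p = 0"
    and "xy_mon n m" "xy_mon n m'" "image_exp (rees_exp n) m = image_exp (rees_exp n) m'"
  shows "mterm m - mterm m' \<in> M"
  using assms(6-)
proof (induction "\<Sum>j < n. nat \<bar>ydiff n m m' j\<bar>" arbitrary: m rule: less_induct)
  case less
  define \<delta> where "\<delta> = ydiff n m m'"
  note xy = less.prems(1,2) and img = less.prems(3)
  have n0: "n > 0" using n by simp
  have mult0: "\<delta> (j mod n) = \<delta> j" for j by (simp add: \<delta>_def ydiff_def)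
  have x_diff: "int (Poly_Mapping.lookup m (XVar (i mod n))) - int (Poly_Mapping.lookup m' (XVar (i mod n))) =
      \<delta> (i + 1) + \<delta> (i + 2)" for i
    unfolding \<delta>_def by (rule ydiff_relations(2)[OF n xy img])
  have x_pos: "Poly_Mapping.lookup m (XVar (i mod n)) \<ge> 1" if "\<delta> (i + 1) + \<delta> (i + 2) > 0" for i
    using x_diff[of i] that by linarith
  have sum0: "(\<Sum>j < n. \<delta> j) = 0" unfolding \<delta>_def by (rule ydiff_relations(1)[OF n xy img])
  \<comment> \<open>Replacing a divisor \<open>t\<close> of \<open>m\<close> by \<open>t'\<close> decreases the measure if \<open>t\<close> takes away some
    \<open>y\<close>-variable, at most the surplus of each, and \<open>t'\<close> adds at most what is missing of each.\<close>
  have move: "mterm m - mterm m' \<in> M"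
    if tM: "mterm t - mterm t' \<in> M" and t': "xy_mon n t" "xy_mon n t'"
      and tx: "\<And>i. i < n \<Longrightarrow> Poly_Mapping.lookup t (XVar i) \<le> Poly_Mapping.lookup m (XVar i)"
      and ty: "\<And>j. j < n \<Longrightarrow> int (Poly_Mapping.lookup t (YVar j)) \<le> max 0 (\<delta> j)"
      and ty': "\<And>j. j < n \<Longrightarrow> int (Poly_Mapping.lookup t' (YVar j)) \<le> max 0 (- \<delta> j)"
      and pos: "p < n" "Poly_Mapping.lookup t (YVar p) > 0" for t t' p
  proof -
    have le: "Poly_Mapping.lookup t v \<le> Poly_Mapping.lookup m v" for v
    proof (cases "v \<in> Poly_Mapping.keys t")
      case True
      then consider i where "i < n" "v = XVar i" | j where "j < n" "v = YVar j" using t'(1) by auto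
      then show ?thesis
      proof cases
        case (2 j)
        then show ?thesis using ty[of j] by (simp add: \<delta>_def ydiff_def)
      qed (use tx in auto)
    qed (simp add: in_keys_iff)
    define m1 where "m1 = m - t + t'"
    have m_m1: "mterm m - mterm m1 \<in> M"
      unfolding m1_def by (rule move_in_ideal[OF M xy(1) tM le])
    have "Poly_Mapping.keys (m - t) \<subseteq> Poly_Mapping.keys m" by (auto simp: in_keys_iff lookup_minus)
    then have xy1: "xy_mon n m1" using xy(1) t'(2) unfolding m1_def by (intro xy_mon_add) auto
    have "(mterm (image_exp (rees_exp n) m) - mterm (image_exp (rees_exp n) m1) :: (var, 'k) mpoly) = 0"
      using ker[OF m_m1] by (simp add: rees_map_eq psubst_diff psubst_mterm)
    then have "Poly_Mapping.lookup (mterm (image_exp (rees_exp n) m) :: (var, 'k) mpoly) (image_exp (rees_exp n) m1) = 1"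
      by simp
    then have img1: "image_exp (rees_exp n) m1 = image_exp (rees_exp n) m'"
      using img by (simp add: lookup_single when_def split: if_splits)
    have d1: "ydiff n m1 m' j = \<delta> j - int (Poly_Mapping.lookup t (YVar j)) + int (Poly_Mapping.lookup t' (YVar j))"
      if "j < n" for j
      using that le[of "YVar j"] by (simp add: \<delta>_def ydiff_def m1_def lookup_add lookup_minus of_nat_diff)
    have "(\<Sum>j < n. nat \<bar>ydiff n m1 m' j\<bar>) < (\<Sum>j < n. nat \<bar>\<delta> j\<bar>)"
    proof (rule sum_strict_mono_ex1)
      show "\<forall>j \<in> {..<n}. nat \<bar>ydiff n m1 m' j\<bar> \<le> nat \<bar>\<delta> j\<bar>"
        using d1 ty ty' by (fastforce simp: max_def split: if_splits)
      show "\<exists>j \<in> {..<n}. nat \<bar>ydiff n m1 m' j\<bar> < nat \<bar>\<delta> j\<bar>"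
        using d1[of p] ty[of p] ty'[of p] pos by (intro bexI[of _ p]) (auto simp: max_def split: if_splits)
    qed simp
    then have "mterm m1 - mterm m' \<in> M"
      unfolding \<delta>_def using xy1 xy(2) img1 by (rule less.hyps)
    from ideal_xy_add[OF M m_m1 this] show ?thesis by simp
  qed
  note lookups = lookup_add lookup_xe lookup_ye
  note supports = xy_mon_add xy_mon_xe_ye[OF n0]
  have ypos: "int (of_bool (j = i mod n)) \<le> max 0 (\<delta> j)" if "\<delta> i > 0" for i j
    using that mult0[of i] by auto
  have yneg: "int (of_bool (j = i mod n)) \<le> max 0 (- \<delta> j)" if "\<delta> i < 0" for i j
    using that mult0[of i] by auto
  have xpos: "of_bool (l = i mod n) \<le> Poly_Mapping.lookup m (XVar l)"
    if "\<delta> (i + 1) + \<delta> (i + 2) > 0" for i l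
    using x_pos[OF that] by auto
  have ne: "i mod n \<noteq> (i + 1) mod n" for i
    using n by (auto simp: mod_Suc)
  have idx: "xe n (n - 2 + (i + 2)) = xe n i" "xe n (n - 1 + (i + 2)) = xe n (i + 1)" for i
  proof -
    have "n - 2 + (i + 2) = n + i" "n - 1 + (i + 2) = n + (i + 1)" using n by auto
    then show "xe n (n - 2 + (i + 2)) = xe n i" "xe n (n - 1 + (i + 2)) = xe n (i + 1)"
      by (simp_all only: xe_periodic)
  qed
  show ?case
  proof (cases "\<exists>k. \<delta> k < 0")
    case False
    \<comment> \<open>A nonnegative \<open>\<delta>\<close> with sum zero vanishes, and then the exponents of the \<open>x\<^sub>i\<close> agree as well.\<close>
    then have nonneg: "\<delta> j \<ge> 0" for j by (simp add: not_less)
    then have "\<delta> j = 0" if "j < n" for j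
      using that sum0 sum_nonneg_eq_0_iff[of "{..<n}" \<delta>] by auto
    then have d0: "\<delta> j = 0" for j using mult0[of j] n0 by (metis mod_less_divisor)
    have "m = m'"
    proof (rule poly_mapping_eqI)
      fix v
      consider i where "i < n" "v = XVar i" | j where "j < n" "v = YVar j"
        | "v \<notin> Poly_Mapping.keys m" "v \<notin> Poly_Mapping.keys m'" using xy by blast
      then show "Poly_Mapping.lookup m v = Poly_Mapping.lookup m' v"
      proof cases
        case (1 i)
        then show ?thesis using x_diff[of i] d0 by simp
      next
        case (2 j)
        then show ?thesis using d0[of j] by (simp add: \<delta>_def ydiff_def)
      qed (simp add: in_keys_iff)
    qed
    then show ?thesis using ideal_xy_zero[OF M] by simp
  next
    case True
    then obtain k where k: "\<delta> k < 0" by blast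
    have "\<delta> (i + n) = \<delta> i" for i by (simp add: \<delta>_def ydiff_def)
    from n0 this sum0 k show ?thesis
    proof (cases rule: cyclic_sign_pattern)
      case (forward i)
      have "f_gen n (i + 2) = (mterm (xe n i + ye n (i + 2)) - mterm (xe n (i + 2) + ye n (i + 3)) :: (var, 'k) mpoly)"
        unfolding f_gen_eq idx by (simp add: numeral_3_eq_3)
      then have "mterm (xe n i + ye n (i + 2)) - mterm (xe n (i + 2) + ye n (i + 3)) \<in> M"
        using f[of "i + 2"] by simp
      then show ?thesis
      proof (rule move[where p = "(i + 2) mod n"])
        fix l
        show "Poly_Mapping.lookup (xe n i + ye n (i + 2)) (XVar l) \<le> Poly_Mapping.lookup m (XVar l)"
          using xpos[OF forward(1), of l] by (simp add: lookups)
        show "int (Poly_Mapping.lookup (xe n i + ye n (i + 2)) (YVar l)) \<le> max 0 (\<delta> l)"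
          using ypos[OF forward(2), of l] by (simp add: lookups)
        show "int (Poly_Mapping.lookup (xe n (i + 2) + ye n (i + 3)) (YVar l)) \<le> max 0 (- \<delta> l)"
          using yneg[OF forward(3), of l] by (simp add: lookups)
      qed (use n0 in \<open>simp_all add: lookups supports\<close>)
    next
      case (backward i)
      have "- f_gen n i = (mterm (xe n i + ye n (i + 1)) - mterm (xe n (n - 2 + i) + ye n i) :: (var, 'k) mpoly)"
        unfolding f_gen_eq by simp
      then have "mterm (xe n i + ye n (i + 1)) - mterm (xe n (n - 2 + i) + ye n i) \<in> M"
        using ideal_xy_uminus[OF M f[of i]] by simp
      then show ?thesis
      proof (rule move[where p = "(i + 1) mod n"])
        fix l
        show "Poly_Mapping.lookup (xe n i + ye n (i + 1)) (XVar l) \<le> Poly_Mapping.lookup m (XVar l)"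
          using xpos[OF backward(1), of l] by (simp add: lookups)
        show "int (Poly_Mapping.lookup (xe n i + ye n (i + 1)) (YVar l)) \<le> max 0 (\<delta> l)"
          using ypos[OF backward(2), of l] by (simp add: lookups)
        show "int (Poly_Mapping.lookup (xe n (n - 2 + i) + ye n i) (YVar l)) \<le> max 0 (- \<delta> l)"
          using yneg[OF backward(3), of l] by (simp add: lookups)
      qed (use n0 in \<open>simp_all add: lookups supports\<close>)
    next
      case (jump i)
      show ?thesis
      proof (rule move[where p = "(i + 2) mod n"])
        show "mterm (xe n i + xe n (i + 1) + ye n (i + 2)) -
            mterm (xe n (n - 2 + k) + xe n (n - 1 + k) + ye n k) \<in> M"
          using edge_exchange[OF n M f, of "i + 2" k] unfolding idx .
        fix l
        have "\<delta> (i + 1 + 1) + \<delta> (i + 1 + 2) > 0" using jump(3) by (simp add: numeral_3_eq_3)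
        then show "Poly_Mapping.lookup (xe n i + xe n (i + 1) + ye n (i + 2)) (XVar l) \<le> Poly_Mapping.lookup m (XVar l)"
          using xpos[OF jump(1), of l] xpos[of "i + 1" l] ne[of i]
          by (cases "l = i mod n") (simp_all add: lookups)
        show "int (Poly_Mapping.lookup (xe n i + xe n (i + 1) + ye n (i + 2)) (YVar l)) \<le> max 0 (\<delta> l)"
          using ypos[OF jump(2), of l] by (simp add: lookups)
        show "int (Poly_Mapping.lookup (xe n (n - 2 + k) + xe n (n - 1 + k) + ye n k) (YVar l)) \<le> max 0 (- \<delta> l)"
          using yneg[OF k, of l] by (simp add: lookups)
      qed (use n0 in \<open>simp_all add: lookups supports\<close>)
    next
      case alternating
      have hM: "mterm (even_ys n) - mterm (odd_ys n) \<in> M" using h[OF alternating(1)] by (simp add: h_gen_eq)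
      have hM': "mterm (odd_ys n) - mterm (even_ys n) \<in> M" using ideal_xy_uminus[OF M hM] by simp
      have sup: "xy_mon n (even_ys n)" "xy_mon n (odd_ys n)"
        unfolding even_ys_def odd_ys_def by (rule xy_mon_sum, rule xy_mon_xe_ye[OF n0])+
      have X0: "Poly_Mapping.lookup (even_ys n) (XVar i) = 0" "Poly_Mapping.lookup (odd_ys n) (XVar i) = 0" for i
        by (simp_all add: even_ys_def odd_ys_def lookup_sum lookup_ye)
      have n2: "n \<ge> 2" using n by simp
      note Y = lookup_even_ys[OF alternating(1) n2] lookup_odd_ys[OF alternating(1) n2]
      define c where "c = \<delta> 0"
      have alt: "\<delta> j = (if even j then c else - c)" for j unfolding c_def by (rule alternating(3))
      show ?thesis
      proof (cases "c > 0")
        case True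
        show ?thesis
          by (rule move[OF hM sup, of 0]) (use True n0 alt in \<open>auto simp: X0 Y\<close>)
      next
        case False
        then have "c < 0" using alternating(2) by (simp add: c_def)
        then show ?thesis
          by (intro move[OF hM' sup(2,1), of 1]) (use n alt in \<open>auto simp: X0 Y\<close>)
      qed
    qed
  qed
qed

section \<open>The Rees ideal\<close>

lemma rees_ideal_eq: "rees_ideal n = {p \<in> carrier (ring_xy n). rees_map n p = 0}"
  by (simp add: rees_ideal_def a_kernel_def')

lemma rees_ideal_ideal:
  assumes "n \<ge> 3"
  shows "ideal (rees_ideal n :: (var, 'k :: comm_ring_1) mpoly set) (ring_xy n)"
proof -
  interpret Q: cring "ring_xs n :: (var, 'k) mpoly ring" unfolding ring_xs_def by (rule poly_ring_cring)
  have "ring (rees_algebra n :: (var, 'k) mpoly ring)"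
    using Q.subring_is_ring[OF rees_algebra_subring[OF assms]] by (simp add: rees_algebra_def)
  then interpret ring_hom_ring "ring_xy n :: (var, 'k) mpoly ring" "rees_algebra n" "rees_map n"
    using cring.axioms(1)[OF ring_xy_cring] rees_map_hom[OF assms]
    by (intro ring_hom_ring.intro ring_hom_ring_axioms.intro)
  show ?thesis unfolding rees_ideal_def by (rule kernel_is_ideal)
qed

text \<open>
  Both parities follow from this: \<open>M\<close> is \<open>L\<close> for odd \<open>n\<close> and \<open>L + HT\<close> for even \<open>n\<close>.
\<close>

lemma rees_ideal_subset:
  fixes M :: "(var, 'k :: comm_ring_1) mpoly set"
  assumes "n \<ge> 3" "ideal M (ring_xy n)" "\<And>j. f_gen n j \<in> M" "even n \<Longrightarrow> h_gen n \<in> M"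
    and "M \<subseteq> rees_ideal n"
  shows "rees_ideal n \<subseteq> M"
proof
  fix p :: "(var, 'k) mpoly" assume p: "p \<in> rees_ideal n"
  show "p \<in> M"
  proof (rule monomial_kernel_in)
    show "psubst (\<lambda>v. mterm (rees_exp n v)) p = 0" using p by (simp add: rees_ideal_eq rees_map_eq)
    show "Const c * q \<in> M" if "q \<in> M" for c q
      by (rule ideal_xy_mult[OF assms(2) _ that]) (simp add: ring_xy_def Const_in_carrier)
    fix m m'
    assume "m \<in> Poly_Mapping.keys p" "m' \<in> Poly_Mapping.keys p"
      and img: "image_exp (rees_exp n) m = image_exp (rees_exp n) m'"
    then have "xy_mon n m" "xy_mon n m'"
      using p by (auto simp: rees_ideal_eq ring_xy_def carrier_poly_ring)
    then show "mterm m - mterm m' \<in> M"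
      using assms(5) img
      by (intro same_image_difference_in_ideal[OF assms(1-4)]) (auto simp: rees_ideal_eq)
  qed (use ideal_xy_closed[OF assms(2)] in auto)
qed

lemma f_gen_carrier: "n > 0 \<Longrightarrow> f_gen n j \<in> carrier (ring_xy n :: (var, 'k :: comm_ring_1) mpoly ring)"
  unfolding f_gen_eq diff_conv_add_uminus ring_xy_def
  by (intro add_in_carrier uminus_in_carrier)
    (simp_all only: mterm_in_ring_xy[unfolded ring_xy_def] xy_mon_add xy_mon_xe_ye)

lemma h_gen_carrier:
  assumes "n > 0"
  shows "h_gen n \<in> carrier (ring_y n :: (var, 'k :: comm_ring_1) mpoly ring)"
  unfolding h_gen_def diff_conv_add_uminus ring_y_def
  by (intro add_in_carrier uminus_in_carrier prod_in_carrier)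
    (use assms in \<open>simp_all add: yv_def Var_in_carrier\<close>)

lemma ring_y_subset_xy: "carrier (ring_y n) \<subseteq> carrier (ring_xy n)"
  unfolding ring_y_def ring_xy_def by (auto simp: carrier_poly_ring) blast

lemma f_gen_in_rees_ideal: "n \<ge> 3 \<Longrightarrow> f_gen n j \<in> rees_ideal n"
  using f_gen_carrier[of n j]
  by (simp add: rees_ideal_eq rees_map_eq f_gen_eq psubst_diff psubst_mterm del: One_nat_def add_diff_assoc2)
    (simp only: image_exp_f_gen)

lemma h_gen_in_rees_ideal: "n \<ge> 3 \<Longrightarrow> even n \<Longrightarrow> h_gen n \<in> rees_ideal n"
  using h_gen_carrier[of n] ring_y_subset_xy[of n]
  by (auto simp: rees_ideal_eq rees_map_eq h_gen_eq psubst_diff psubst_mterm image_exp_h_gen)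

lemma L_ideal_gens:
  assumes "n > 0"
  shows "ideal (L_ideal n :: (var, 'k :: comm_ring_1) mpoly set) (ring_xy n)"
    and "f_gen n j \<in> (L_ideal n :: (var, 'k) mpoly set)"
proof -
  interpret T: cring "ring_xy n :: (var, 'k) mpoly ring" by (rule ring_xy_cring)
  let ?F = "{f_gen n j | j. j \<in> {1..n}} :: (var, 'k) mpoly set"
  have F: "?F \<subseteq> carrier (ring_xy n)" using f_gen_carrier[OF assms] by auto
  show "ideal (L_ideal n :: (var, 'k) mpoly set) (ring_xy n)"
    unfolding L_ideal_def by (rule T.genideal_ideal[OF F])
  obtain i where "i \<in> {1..n}" "i mod n = j mod n"
  proof (cases "j mod n = 0")
    case True
    then show ?thesis using assms by (intro that[of n]) auto
  next
    case False
    then show ?thesis using assms by (intro that[of "j mod n"]) (auto simp: less_imp_le)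
  qed
  then have "f_gen n j = (f_gen n i :: (var, 'k) mpoly)"
    unfolding f_gen_def xv_def yv_def by (metis mod_add_left_eq mod_add_right_eq)
  then show "f_gen n j \<in> (L_ideal n :: (var, 'k) mpoly set)"
    unfolding L_ideal_def using T.genideal_self[OF F] \<open>i \<in> {1..n}\<close> by auto
qed

lemma L_ideal_subset_rees_ideal: "n \<ge> 3 \<Longrightarrow> L_ideal n \<subseteq> (rees_ideal n :: (var, 'k :: comm_ring_1) mpoly set)"
  unfolding L_ideal_def
  by (rule ring.genideal_minimal[OF cring.axioms(1)[OF ring_xy_cring] rees_ideal_ideal])
    (auto simp: f_gen_in_rees_ideal)

lemma HT_ideal_gens:
  assumes "n \<ge> 3" "even n"
  shows "ideal (HT_ideal n :: (var, 'k :: comm_ring_1) mpoly set) (ring_xy n)"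
    and "h_gen n \<in> (HT_ideal n :: (var, 'k) mpoly set)"
    and "HT_ideal n \<subseteq> (rees_ideal n :: (var, 'k) mpoly set)"
proof -
  interpret T: cring "ring_xy n :: (var, 'k) mpoly ring" by (rule ring_xy_cring)
  interpret Y: cring "ring_y n :: (var, 'k) mpoly ring" unfolding ring_y_def by (rule poly_ring_cring)
  have hc: "h_gen n \<in> carrier (ring_y n :: (var, 'k) mpoly ring)" using assms by (simp add: h_gen_carrier)
  \<comment> \<open>The ideal \<open>H\<close> is taken in the subring \<open>K[y]\<close>, so its elements are described as multiples of \<open>h\<close>
    before they are considered in \<open>T\<close>.\<close>
  have H: "H_ideal n = {r * h_gen n | r. r \<in> carrier (ring_y n :: (var, 'k) mpoly ring)}"
    unfolding H_ideal_def Y.cgenideal_eq_genideal[OF hc, symmetric] cgenideal_def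
    by (simp add: ring_y_def)
  have "H_ideal n \<subseteq> carrier (ring_y n :: (var, 'k) mpoly ring)"
    using hc by (auto simp: H ring_y_def mult_in_carrier)
  then have HT: "H_ideal n \<subseteq> carrier (ring_xy n :: (var, 'k) mpoly ring)"
    using ring_y_subset_xy by blast
  show "ideal (HT_ideal n :: (var, 'k) mpoly set) (ring_xy n)"
    unfolding HT_ideal_def by (rule T.genideal_ideal[OF HT])
  show "h_gen n \<in> (HT_ideal n :: (var, 'k) mpoly set)"
    unfolding HT_ideal_def H_ideal_def
    using T.genideal_self[OF HT] Y.genideal_self'[OF hc] unfolding H_ideal_def by blast
  have "H_ideal n \<subseteq> (rees_ideal n :: (var, 'k) mpoly set)"
    unfolding H using ideal_xy_mult[OF rees_ideal_ideal[OF assms(1)] _ h_gen_in_rees_ideal[OF assms]]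
      ring_y_subset_xy by blast
  then show "HT_ideal n \<subseteq> (rees_ideal n :: (var, 'k) mpoly set)"
    unfolding HT_ideal_def by (rule T.genideal_minimal[OF rees_ideal_ideal[OF assms(1)]])
qed

theorem theorem4p4:
  fixes n :: nat
  assumes "n \<ge> 3"
  shows "(odd n \<longrightarrow> (rees_ideal n :: (var, 'k :: field) mpoly set) = L_ideal n) \<and>
         (even n \<longrightarrow> (rees_ideal n :: (var, 'k) mpoly set) = L_ideal n <+>\<^bsub>ring_xy n\<^esub> HT_ideal n)"
proof (intro conjI impI)
  have n0: "n > 0" using assms by simp
  note L = L_ideal_gens[OF n0, where 'k = 'k] and LJ = L_ideal_subset_rees_ideal[OF assms, where 'k = 'k]
  {
    assume "odd n"
    then show "(rees_ideal n :: (var, 'k) mpoly set) = L_ideal n"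
      using rees_ideal_subset[OF assms L(1) L(2) _ LJ] LJ by blast
  next
    assume ev: "even n"
    interpret T: cring "ring_xy n :: (var, 'k) mpoly ring" by (rule ring_xy_cring)
    let ?M = "L_ideal n <+>\<^bsub>ring_xy n\<^esub> HT_ideal n :: (var, 'k) mpoly set"
    note H = HT_ideal_gens[OF assms ev, where 'k = 'k]
    have M: "?M = {p + q | p q. p \<in> L_ideal n \<and> q \<in> HT_ideal n}"
      by (auto simp: set_add_def')
    have MJ: "?M \<subseteq> rees_ideal n"
      unfolding M using LJ H(3) ideal_xy_add[OF rees_ideal_ideal[OF assms]] by blast
    have "f_gen n j \<in> ?M" for j
      unfolding M using L(2)[of j] ideal_xy_zero[OF H(1)] by force
    moreover have "h_gen n \<in> ?M"
      unfolding M using H(2) ideal_xy_zero[OF L(1)] by force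
    ultimately show "(rees_ideal n :: (var, 'k) mpoly set) = ?M"
      using rees_ideal_subset[OF assms T.add_ideals[OF L(1) H(1)] _ _ MJ] MJ by blast
  }
qed

end
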